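(* Let $d$ be a positive integer. For any graph $G$ of girth $g$ and average degree $48(d+1)$, $|C(G)|\ge \frac18 d^{\lfloor (g-1)/2\rfloor}$.
   Context: $C(G)$ is the set of lengths of cycles in $G$. The average degree of $G$ is $2|E(G)|/|V(G)|$; the girth is the length of a shortest cycle. *)

theory Defs
  imports Complex_Main "HOL-Library.Extended_Nat"
begin

definition finite_simple_graph :: "'a set \<Rightarrow> 'a set set \<Rightarrow> bool" where
  "finite_simple_graph V E \<longleftrightarrow> finite V \<and> (\<forall>e\<in>E. e \<subseteq> V \<and> card e = 2)"

definition average_degree :: "'a set \<Rightarrow> 'a set set \<Rightarrow> real" where
  "average_degree V E = 2 * real (card E) / real (card V)"

text \<open>A cycle is given by the list of its pairwise distinct vertices in cyclic order, the
  first vertex not being repeated at the end; its length is thus the length of the list.\<close>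

definition is_cycle :: "'a set \<Rightarrow> 'a set set \<Rightarrow> 'a list \<Rightarrow> bool" where
  "is_cycle V E c \<longleftrightarrow> 3 \<le> length c \<and> distinct c \<and> set c \<subseteq> V \<and>
     (\<forall>i<length c. {c ! i, c ! (Suc i mod length c)} \<in> E)"

definition cycle_lengths :: "'a set \<Rightarrow> 'a set set \<Rightarrow> nat set" where
  "cycle_lengths V E = {length c | c. is_cycle V E c}"

text \<open>The girth of an acyclic graph is \<open>\<infinity>\<close>, the infimum of the empty set.\<close>

definition girth :: "'a set \<Rightarrow> 'a set set \<Rightarrow> enat" where
  "girth V E = Inf (enat ` cycle_lengths V E)"

lemma finite_cycle_lengths:
  assumes "finite_simple_graph V E"
  shows "finite (cycle_lengths V E)"
proof (rule finite_subset)
  show "cycle_lengths V E \<subseteq> {..card V}"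
    using assms
    by (auto simp: cycle_lengths_def is_cycle_def finite_simple_graph_def
        intro!: card_mono simp flip: distinct_card)
qed simp

end

theory Submission
  imports Defs
begin

text \<open>Pass to a connected subgraph of at least the same density and take a breadth-first tree. The
  edges inside layer \<open>n\<close> or between layers \<open>n\<close> and \<open>n + 1\<close> form, for some \<open>n\<close>, a subgraph of at least
  half the density. In a subgraph of it of large minimum degree, small vertex sets expand, since
  otherwise they would span a dense graph of few vertices, against the Moore bound; so depth-first
  search finds a path on a constant fraction of the Moore bound many vertices. At least about half
  of these vertices are in layer \<open>n\<close>. Let \<open>k\<close> be least such that all of them have the same
  \<open>(k + 1)\<close>-st ancestor, and colour them by their \<open>k\<close>-th ancestors: any two of different colours
  close a segment of the path to a cycle through the tree, which adds the same number \<open>2 * k + 2\<close> of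
  edges each time. The number of distances between differently coloured vertices of the path is
  at least a quarter of the number of vertices of layer \<open>n\<close>.\<close>

section \<open>Paths and closed paths in a relation\<close>

text \<open>Graphs are treated as symmetric irreflexive relations that hold both orientations of
  every edge. Thus \<open>card R\<close> is the sum of the degrees, and
  \<open>c * card S \<le> card (Restr R S)\<close> says that \<open>S\<close> spans average degree
  at least \<open>c\<close>.\<close>

definition path :: "('a \<times> 'a) set \<Rightarrow> 'a list \<Rightarrow> bool" where
  "path R xs \<longleftrightarrow> distinct xs \<and> successively (\<lambda>x y. (x, y) \<in> R) xs"

definition closed_path :: "('a \<times> 'a) set \<Rightarrow> 'a list \<Rightarrow> bool" where
  "closed_path R xs \<longleftrightarrow> 3 \<le> length xs \<and> path R xs \<and> (last xs, hd xs) \<in> R"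

lemma path_mono: "path R xs \<Longrightarrow> R \<subseteq> R' \<Longrightarrow> path R' xs"
  unfolding path_def by (auto intro: successively_mono)

lemma closed_path_mono: "closed_path R xs \<Longrightarrow> R \<subseteq> R' \<Longrightarrow> closed_path R' xs"
  unfolding closed_path_def by (auto intro: path_mono)

lemma path_sublist: "path R (xs @ ys @ zs) \<Longrightarrow> path R ys"
  unfolding path_def by (auto simp: successively_append_iff)

section \<open>Distances between integers of different colours\<close>

text \<open>Some consecutive elements \<open>i < j\<close> of \<open>I\<close> have different
  colours. The elements from \<open>j\<close> on, and likewise those up to \<open>i\<close>, are
  split by whether they are compared with \<open>i\<close> or with \<open>j\<close>. On each of the
  four classes the distance to the chosen one is injective, so one class with a quarter of
  \<open>I\<close> gives enough distances.\<close>

lemma colour_distances: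
  fixes I :: "nat set" and c :: "nat \<Rightarrow> 'b"
  assumes "finite I" "\<exists>s\<in>I. \<exists>t\<in>I. c s \<noteq> c t"
  shows "card I \<le> 4 * card {t - s |s t. s \<in> I \<and> t \<in> I \<and> s < t \<and> c s \<noteq> c t}"
    (is "_ \<le> 4 * card ?D")
proof -
  define a where "a = Min I"
  define J where "J = {x \<in> I. c x \<noteq> c a}"
  define j where "j = Min J"
  define K where "K = {x \<in> I. x < j}"
  define i where "i = Max K"
  have aI: "a \<in> I" "\<And>x. x \<in> I \<Longrightarrow> a \<le> x"
    unfolding a_def using assms by (auto intro!: Min_in)
  have "J \<noteq> {}" "finite J" using assms unfolding J_def by force+
  hence j: "j \<in> J" "\<And>x. x \<in> J \<Longrightarrow> j \<le> x" unfolding j_def by auto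
  have "a \<in> K" using aI j unfolding K_def J_def by (auto simp: le_less)
  moreover have "finite K" using assms unfolding K_def by auto
  ultimately have i: "i \<in> K" "\<And>x. x \<in> K \<Longrightarrow> x \<le> i"
    unfolding i_def by (auto intro!: Max_in)
  have iI: "i \<in> I" "i < j" using i K_def by auto
  have jI: "j \<in> I" using j J_def by auto
  txt \<open>The colour of any \<open>t\<close> differs from that of \<open>i\<close> or from that of \<open>j\<close>.\<close>
  have cij: "c i \<noteq> c j"
    using i j unfolding K_def J_def by force
  have "?D \<subseteq> (\<lambda>(s, t). t - s) ` (I \<times> I)" by auto
  hence finD: "finite ?D" using assms(1) by (meson finite_SigmaI finite_imageI finite_subset)
  have bound: "card A \<le> card ?D"
    if "inj_on f A" "\<And>x. x \<in> A \<Longrightarrow> f x \<in> ?D" for f :: "nat \<Rightarrow> nat" and A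
    using that card_inj_on_le[of f A ?D] finD by blast
  let ?U1 = "{t \<in> I. j \<le> t \<and> c t \<noteq> c i}" and ?U2 = "{t \<in> I. j \<le> t \<and> c t = c i}"
  let ?V1 = "{t \<in> I. t \<le> i \<and> c t \<noteq> c j}" and ?V2 = "{t \<in> I. t \<le> i \<and> c t = c j}"
  have "card ?U1 \<le> card ?D"
  proof (rule bound[of "\<lambda>t. t - i"])
    fix t assume "t \<in> ?U1" thus "t - i \<in> ?D" using iI by (intro CollectI exI[of _ i] exI[of _ t]) auto
  qed (use iI in \<open>auto simp: inj_on_def\<close>)
  moreover have "card ?U2 \<le> card ?D"
  proof (rule bound[of "\<lambda>t. t - j"])
    fix t assume "t \<in> ?U2" thus "t - j \<in> ?D" using jI cij
      by (intro CollectI exI[of _ j] exI[of _ t]) (auto simp: le_less)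
  qed (auto simp: inj_on_def)
  moreover have "card ?V1 \<le> card ?D"
  proof (rule bound[of "\<lambda>t. j - t"])
    fix t assume "t \<in> ?V1" thus "j - t \<in> ?D" using iI jI by (intro CollectI exI[of _ t] exI[of _ j]) auto
  qed (use iI in \<open>auto simp: inj_on_def\<close>)
  moreover have "card ?V2 \<le> card ?D"
  proof (rule bound[of "\<lambda>t. i - t"])
    fix t assume "t \<in> ?V2" thus "i - t \<in> ?D" using iI cij
      by (intro CollectI exI[of _ t] exI[of _ i]) (auto simp: le_less)
  qed (auto simp: inj_on_def)
  moreover have "card I \<le> card ?U1 + card ?U2 + card ?V1 + card ?V2"
  proof -
    \<comment> \<open>Nothing of \<open>I\<close> lies strictly between \<open>i\<close> and
      \<open>j\<close>, as \<open>i\<close> is its largest element below \<open>j\<close>.\<close>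
    have "I \<subseteq> ?U1 \<union> ?U2 \<union> ?V1 \<union> ?V2" using i(2) unfolding K_def by force
    hence "card I \<le> card (?U1 \<union> ?U2 \<union> ?V1 \<union> ?V2)" using assms(1) by (intro card_mono) auto
    thus ?thesis
      using card_Un_le[of "?U1 \<union> ?U2 \<union> ?V1" ?V2] card_Un_le[of "?U1 \<union> ?U2" ?V1]
        card_Un_le[of ?U1 ?U2] by linarith
  qed
  ultimately show ?thesis by linarith
qed

section \<open>Dense subgraphs and depth-first search\<close>

text \<open>A nonempty subset of least size among those of average degree at least \<open>c\<close>
  works. Deleting a vertex destroys twice its degree in ordered pairs, so a degree of at most
  \<open>c / 2\<close> would leave a smaller such subset; were the subset disconnected, one of two
  separated pieces would still be dense enough.\<close>

lemma dense_core:
  assumes "finite S0" "S0 \<noteq> {}" "sym R" "irrefl R" "c > 0" "c * card S0 \<le> card (Restr R S0)"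
  obtains S where "S \<subseteq> S0" "S \<noteq> {}" "c * card S \<le> card (Restr R S)"
    "\<And>v. v \<in> S \<Longrightarrow> c < 2 * card (Restr R S `` {v})"
    "\<And>u v. u \<in> S \<Longrightarrow> v \<in> S \<Longrightarrow> (u, v) \<in> (Restr R S)\<^sup>*"
proof -
  let ?P = "\<lambda>S. S \<subseteq> S0 \<and> S \<noteq> {} \<and> c * card S \<le> card (Restr R S)"
  define S where "S = arg_min card ?P"
  have PS: "?P S" unfolding S_def using assms by (intro arg_min_natI[of ?P S0]) auto
  have finS: "finite S" using PS assms(1) finite_subset by blast
  have min: "card (Restr R T) < c * card T" if "T \<subset> S" "T \<noteq> {}" for T
  proof (rule ccontr)
    assume "\<not> ?thesis"
    hence "?P T" using that PS by auto
    hence "card S \<le> card T" unfolding S_def by (rule arg_min_nat_le)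
    thus False using psubset_card_mono[OF finS that(1)] by simp
  qed
  have finR: "finite (Restr R T)" if "T \<subseteq> S" for T
    using that finS by (meson finite_Int finite_SigmaI finite_subset)
  show ?thesis
  proof (rule that[of S])
    fix v assume v: "v \<in> S"
    let ?N = "Restr R S `` {v}"
    have finN: "finite ?N" using finS by (auto intro: finite_subset[of _ S])
    have "Restr R S \<subseteq> Restr R (S - {v}) \<union> Pair v ` ?N \<union> (\<lambda>u. (u, v)) ` ?N"
      using assms(3) by (auto dest: symD)
    hence "card (Restr R S) \<le> card (Restr R (S - {v}) \<union> Pair v ` ?N \<union> (\<lambda>u. (u, v)) ` ?N)"
      using finR[of "S - {v}"] finN by (intro card_mono) auto
    also have "\<dots> \<le> card (Restr R (S - {v})) + card (Pair v ` ?N) + card ((\<lambda>u. (u, v)) ` ?N)"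
      by (meson add_le_mono card_Un_le le_trans order_refl)
    also have "\<dots> \<le> card (Restr R (S - {v})) + 2 * card ?N"
      using card_image_le[OF finN, of "Pair v"] card_image_le[OF finN, of "\<lambda>u. (u, v)"] by linarith
    finally have le: "c * card S \<le> card (Restr R (S - {v})) + 2 * card ?N" using PS by linarith
    show "c < 2 * card ?N"
    proof (cases "S = {v}")
      \<comment> \<open>Here \<open>S - {v}\<close> is empty and \<open>min\<close> says nothing,
        but a single vertex carries no edge, against \<open>c > 0\<close>.\<close>
      case True
      hence "Restr R S = {}" using assms(4) by (auto simp: irrefl_def)
      hence "c * card S \<le> 0" using PS by simp
      thus ?thesis using True assms(5) by simp
    next
      case False
      hence "card (Restr R (S - {v})) < c * card (S - {v})" using v by (intro min) auto
      moreover have "c * card S = c * card (S - {v}) + c"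
        using card.remove[OF finS v] by simp
      ultimately show ?thesis using le by linarith
    qed
  next
    fix u v assume uv: "u \<in> S" "v \<in> S"
    \<comment> \<open>\<open>T\<close> is the component of \<open>u\<close>. No edge leaves it, so
      if it were proper, the edges would split between two parts that are both too sparse by
      \<open>min\<close>.\<close>
    define T where "T = {w \<in> S. (u, w) \<in> (Restr R S)\<^sup>*}"
    have T: "T \<subseteq> S" "u \<in> T" using uv unfolding T_def by auto
    have sub: "Restr R S \<subseteq> Restr R T \<union> Restr R (S - T)"
    proof (rule subrelI)
      fix x y assume xy: "(x, y) \<in> Restr R S"
      hence "(y, x) \<in> Restr R S" using assms(3) by (auto dest: symD)
      with xy have "x \<in> T \<longleftrightarrow> y \<in> T" unfolding T_def by (auto intro: rtrancl_into_rtrancl)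
      thus "(x, y) \<in> Restr R T \<union> Restr R (S - T)" using xy by auto
    qed
    show "(u, v) \<in> (Restr R S)\<^sup>*"
    proof (rule ccontr)
      assume "\<not> ?thesis"
      hence "v \<in> S - T" unfolding T_def using uv by auto
      hence "card (Restr R T) < c * card T" "card (Restr R (S - T)) < c * card (S - T)"
        using T by (auto intro!: min)
      moreover have "card (Restr R S) \<le> card (Restr R T) + card (Restr R (S - T))"
        using card_mono[OF _ sub] finR[OF T(1)] finR[of "S - T"] card_Un_le le_trans
        by (metis (no_types, lifting) Diff_subset finite_UnI)
      moreover have "c * card S = c * card T + c * card (S - T)"
        using card_Diff_subset[OF finite_subset[OF T(1) finS] T(1)] card_mono[OF finS T(1)]
        by (simp flip: distrib_left)
      ultimately show False using PS by linarith
    qed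
  qed (use PS in auto)
qed

text \<open>Depth-first search: when \<open>k\<close> vertices have been finished, their neighbours are finished or
  on the stack, which is a path.\<close>

lemma depth_first_search:
  assumes "finite S" "R \<subseteq> S \<times> S" "sym R" "k \<le> card S"
  shows "\<exists>X P. X \<subseteq> S \<and> card X = k \<and> set P \<subseteq> S \<and> path R P \<and> X \<inter> set P = {} \<and>
    R `` X \<subseteq> X \<union> set P"
  using assms(4)
proof (induction k)
  case 0
  show ?case by (intro exI[of _ "{}"] exI[of _ "[]"]) (auto simp: path_def)
next
  case (Suc k)
  then obtain X P0 where X: "X \<subseteq> S" "card X = k" and P0: "set P0 \<subseteq> S" "path R P0"
      "X \<inter> set P0 = {}" "R `` X \<subseteq> X \<union> set P0"
    by auto
  let ?Q = "\<lambda>P. set P \<subseteq> S \<and> path R P \<and> X \<inter> set P = {} \<and> R `` X \<subseteq> X \<union> set P"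
  \<comment> \<open>For fixed \<open>X\<close> take the stack \<open>P\<close> as long as possible,
    its top being the head. It is not empty, since an unvisited vertex could be pushed, and its top
    has no unvisited neighbour, so it can be moved to \<open>X\<close>.\<close>
  have "\<forall>P. ?Q P \<longrightarrow> length P < Suc (card S)"
    using assms(1) by (auto simp: path_def less_Suc_eq_le card_mono simp flip: distinct_card)
  then obtain P where P: "?Q P" and max: "\<And>P'. ?Q P' \<Longrightarrow> length P' \<le> length P"
    using ex_has_greatest_nat[of ?Q P0 length "Suc (card S)"] P0 by blast
  show ?case
  proof (cases P)
    case Nil
    have "X \<noteq> S" using X Suc.prems by auto
    then obtain v where "v \<in> S" "v \<notin> X" using X by auto
    hence "?Q [v]" using P Nil by (auto simp: path_def)
    hence "length [v] \<le> length P" by (rule max)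
    thus ?thesis using Nil by simp
  next
    case (Cons v P')
    have nb: "u \<in> X \<union> set P" if "(v, u) \<in> R" for u
    proof (rule ccontr)
      assume u: "u \<notin> X \<union> set P"
      have "u \<in> S" "(u, v) \<in> R" using that assms(2,3) by (auto dest: symD)
      hence "?Q (u # P)" using u P Cons by (auto simp: path_def)
      hence "length (u # P) \<le> length P" by (rule max)
      thus False by simp
    qed
    show ?thesis
    proof (intro exI[of _ "insert v X"] exI[of _ P'] conjI)
      have "finite X" using X assms(1) finite_subset by auto
      thus "card (insert v X) = Suc k" using X P Cons by auto
      show "path R P'" using P Cons path_sublist[of R "[v]" P' "[]"] by auto
      show "insert v X \<inter> set P' = {}" using P Cons by (auto simp: path_def)
      show "R `` insert v X \<subseteq> insert v X \<union> set P'" using P Cons nb by auto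
    qed (use X P Cons in auto)
  qed
qed

section \<open>The breadth-first tree of a connected graph\<close>

locale connected_graph =
  fixes S :: "'a set" and R :: "('a \<times> 'a) set" and r :: 'a
  assumes finite_vertices: "finite S"
    and edges_subset: "R \<subseteq> S \<times> S"
    and sym_edges: "sym R"
    and irrefl_edges: "irrefl R"
    and root: "r \<in> S"
    and reachable: "v \<in> S \<Longrightarrow> (r, v) \<in> R\<^sup>*"
begin

text \<open>This is the distance from the root. It is unspecified outside \<open>S\<close>, which is
  why \<open>layer\<close> asks for membership in \<open>S\<close>.\<close>

definition height :: "'a \<Rightarrow> nat" where
  "height v = (LEAST n. (r, v) \<in> R ^^ n)"

text \<open>At the root there is no such \<open>u\<close> and the value is arbitrary, so iterates
  are meaningful only up to the height of the vertex.\<close>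

definition parent :: "'a \<Rightarrow> 'a" where
  "parent v = (SOME u. (u, v) \<in> R \<and> Suc (height u) = height v)"

definition layer :: "nat \<Rightarrow> 'a set" where
  "layer i = {v \<in> S. height v = i}"

text \<open>Edges inside the upper layer are left out, so that every edge lies in exactly one band
  and every edge of band \<open>i\<close> has an end in layer \<open>i\<close>.\<close>

definition band :: "nat \<Rightarrow> ('a \<times> 'a) set" where
  "band i = Restr R (layer i \<union> layer (Suc i)) - layer (Suc i) \<times> layer (Suc i)"

lemma height_path: "v \<in> S \<Longrightarrow> (r, v) \<in> R ^^ height v"
  unfolding height_def using reachable by (metis LeastI rtrancl_power)

lemma height_le: "(r, v) \<in> R ^^ n \<Longrightarrow> height v \<le> n"
  unfolding height_def by (rule Least_le)

lemma edge_sym: "(u, v) \<in> R \<Longrightarrow> (v, u) \<in> R"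
  using sym_edges by (auto dest: symD)

lemma edge_verts: "(u, v) \<in> R \<Longrightarrow> u \<in> S \<and> v \<in> S \<and> u \<noteq> v"
  using edges_subset irrefl_edges by (auto simp: irrefl_def)

lemma height_edge: "(u, v) \<in> R \<Longrightarrow> height v \<le> Suc (height u)"
  using height_path[of u] edge_verts[of u v] by (intro height_le) auto

lemma height_0: "v \<in> S \<Longrightarrow> height v = 0 \<Longrightarrow> v = r"
  using height_path[of v] by simp

lemma height_root: "height r = 0"
  using height_le[of r 0] by simp

lemma parent:
  assumes "v \<in> S" "height v = Suc n"
  shows "(parent v, v) \<in> R" "height (parent v) = n" "parent v \<in> S"
proof -
  obtain u where u: "(r, u) \<in> R ^^ n" "(u, v) \<in> R"
    using height_path[OF assms(1)] assms(2) by auto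
  have "Suc (height u) = height v"
    using height_le[OF u(1)] height_edge[OF u(2)] assms(2) by simp
  hence "(parent v, v) \<in> R \<and> Suc (height (parent v)) = height v"
    unfolding parent_def using u(2)
    by - (rule someI[of "\<lambda>u. (u, v) \<in> R \<and> Suc (height u) = height v" u], simp)
  thus "(parent v, v) \<in> R" "height (parent v) = n" "parent v \<in> S"
    using assms(2) edge_verts by auto
qed

lemma ancestor:
  "v \<in> S \<Longrightarrow> k \<le> height v \<Longrightarrow>
    (parent ^^ k) v \<in> S \<and> height ((parent ^^ k) v) = height v - k"
proof (induction k)
  case (Suc k)
  then obtain n where "height v - k = Suc n" by (cases "height v - k") auto
  thus ?case using Suc parent[of "(parent ^^ k) v" n] by simp
qed simp

section \<open>Closing a path through the tree\<close>

text \<open>At step \<open>n\<close> all ancestors are the root, and at step 0 they are not all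
  equal; \<open>k\<close> comes just before the first step at which they agree.\<close>

lemma ancestors_meet:
  assumes "A \<subseteq> layer n" "\<exists>a\<in>A. \<exists>b\<in>A. a \<noteq> b"
  obtains k where "k < n"
    "\<exists>a\<in>A. \<exists>b\<in>A. (parent ^^ k) a \<noteq> (parent ^^ k) b"
    "\<And>a b. a \<in> A \<Longrightarrow> b \<in> A \<Longrightarrow> (parent ^^ Suc k) a = (parent ^^ Suc k) b"
proof -
  let ?P = "\<lambda>k. \<forall>a\<in>A. \<forall>b\<in>A. (parent ^^ k) a = (parent ^^ k) b"
  have n: "?P n"
  proof (intro ballI)
    have "(parent ^^ n) a = r" if "a \<in> A" for a
      using ancestor[of a n] assms(1) that height_0 unfolding layer_def by auto
    thus "(parent ^^ n) a = (parent ^^ n) b" if "a \<in> A" "b \<in> A" for a b using that by metis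
  qed
  define l where "l = (LEAST k. ?P k)"
  have l: "?P l" "l \<le> n" unfolding l_def by (rule LeastI[of ?P, OF n], rule Least_le[of ?P, OF n])
  have "l \<noteq> 0" using l(1) assms(2) by (metis funpow_0)
  then obtain k where k: "l = Suc k" by (cases l) auto
  have "\<not> ?P k" using not_less_Least[of k ?P] k unfolding l_def by auto
  show ?thesis
  proof (rule that)
    show "k < n" using l(2) k by simp
    show "\<exists>a\<in>A. \<exists>b\<in>A. (parent ^^ k) a \<noteq> (parent ^^ k) b" using \<open>\<not> ?P k\<close> by blast
    show "(parent ^^ Suc k) a = (parent ^^ Suc k) b" if "a \<in> A" "b \<in> A" for a b
      using l(1) that unfolding k by blast
  qed
qed

lemma ancestors_meet2:
  assumes "a \<in> layer n" "b \<in> layer n" "a \<noteq> b"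
  shows "\<exists>k<n. (parent ^^ k) a \<noteq> (parent ^^ k) b \<and> (parent ^^ Suc k) a = (parent ^^ Suc k) b"
proof -
  have "{a, b} \<subseteq> layer n" "\<exists>x\<in>{a, b}. \<exists>y\<in>{a, b}. x \<noteq> y" using assms by auto
  then obtain k where k: "k < n"
    "\<exists>x\<in>{a, b}. \<exists>y\<in>{a, b}. (parent ^^ k) x \<noteq> (parent ^^ k) y"
    "\<And>x y. x \<in> {a, b} \<Longrightarrow> y \<in> {a, b} \<Longrightarrow> (parent ^^ Suc k) x = (parent ^^ Suc k) y"
    by (rule ancestors_meet) blast
  have "(parent ^^ k) a \<noteq> (parent ^^ k) b" using k(2) by auto
  moreover have "(parent ^^ Suc k) a = (parent ^^ Suc k) b" by (rule k(3)) auto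
  ultimately show ?thesis using k(1) by blast
qed

text \<open>The parents of the two ends lie below all of \<open>Q\<close>, so they prolong it at
  both ends to a path of the same kind one layer down. After \<open>k\<close> such rounds the two
  parents coincide and this one vertex closes the cycle.\<close>

lemma close_path:
  assumes "a \<in> layer n" "b \<in> layer n" "k < n"
    and "(parent ^^ k) a \<noteq> (parent ^^ k) b" "(parent ^^ Suc k) a = (parent ^^ Suc k) b"
    and "path R Q" "Q \<noteq> []" "hd Q = a" "last Q = b" "\<And>v. v \<in> set Q \<Longrightarrow> n \<le> height v"
  shows "\<exists>c. closed_path R c \<and> length c = length Q + 2 * k + 1"
  using assms
proof (induction k arbitrary: a b Q n)
  case 0
  then obtain n' where n: "n = Suc n'" by (cases n) auto
  note a = parent[of a n'] and b = parent[of b n']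
  have pa: "parent a = parent b" "a \<noteq> b" using 0 by auto
  have "parent a \<notin> set Q" using 0 n a unfolding layer_def by force
  \<comment> \<open>The ends differ, so together with the common parent there are the three vertices
    that a closed path needs.\<close>
  moreover have "2 \<le> length Q" using 0 pa
    by (metis One_nat_def Suc_1 Suc_leI hd_conv_nth last_conv_nth le_neq_implies_less length_greater_0_conv diff_Suc_1)
  ultimately have "closed_path R (parent a # Q)"
    using 0 a b n pa edge_sym[of "parent b" b]
    unfolding closed_path_def path_def layer_def by (cases Q) auto
  thus ?case by (intro exI[of _ "parent a # Q"]) auto
next
  case (Suc k)
  then obtain n' where n: "n = Suc n'" by (cases n) auto
  note a = parent[of a n'] and b = parent[of b n']
  have ab: "a \<in> S" "height a = Suc n'" "b \<in> S" "height b = Suc n'"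
    using Suc.prems n unfolding layer_def by auto
  have ne: "parent a \<noteq> parent b" using Suc.prems(4) by (metis funpow_Suc_right o_apply)
  have "parent a \<notin> set Q" "parent b \<notin> set Q"
    using Suc.prems(10) ab a b n by force+
  hence "path R (parent a # Q @ [parent b])"
    using Suc.prems(6-9) ne a ab b edge_sym[of "parent b" b]
    by (auto simp: path_def successively_append_iff successively_Cons)
  moreover have "(parent ^^ k) (parent a) \<noteq> (parent ^^ k) (parent b)"
    "(parent ^^ Suc k) (parent a) = (parent ^^ Suc k) (parent b)"
    using Suc.prems(4,5) by (simp_all del: funpow.simps add: funpow_Suc_right)
  moreover have "n' \<le> height v" if "v \<in> set (parent a # Q @ [parent b])" for v
    using that Suc.prems(10)[of v] a b ab n by auto
  ultimately have "\<exists>c. closed_path R c \<and> length c = length (parent a # Q @ [parent b]) + 2 * k + 1"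
    using a b ab n Suc.prems(3) by (intro Suc.IH[of "parent a" n' "parent b"]) (auto simp: layer_def)
  thus ?case by simp
qed

section \<open>The Moore bound\<close>

text \<open>A second lower neighbour would close a cycle of length at most
  \<open>2 * height x\<close>, and a neighbour in the same layer one of length at most
  \<open>2 * height x + 1\<close>; both are too short. In the second alternative there is thus no
  such edge at all; the common conclusion lets both cases be used together.\<close>

lemma lower_neighbour_is_parent:
  assumes "\<And>c. closed_path R c \<Longrightarrow> 2 * m < length c"
    and "(x, y) \<in> R" "height y < height x \<and> height x \<le> m \<or> height y = height x \<and> height x < m"
  shows "y = parent x"
proof (rule ccontr)
  assume y: "y \<noteq> parent x"
  have xy: "x \<in> S" "y \<in> S" "x \<noteq> y" using edge_verts assms(2) by auto
  from assms(3) show False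
  proof
    assume *: "height y < height x \<and> height x \<le> m"
    define n where "n = height y"
    have hx: "height x = Suc n" using * height_edge[OF edge_sym[OF assms(2)]] n_def by simp
    note p = parent[OF xy(1) hx]
    obtain k where k: "k < n" "(parent ^^ k) (parent x) \<noteq> (parent ^^ k) y"
        "(parent ^^ Suc k) (parent x) = (parent ^^ Suc k) y"
      using ancestors_meet2[of "parent x" n y] p y xy n_def unfolding layer_def by auto
    have "path R [parent x, x, y]" using p xy assms(2) y by (auto simp: path_def edge_verts)
    hence "\<exists>c. closed_path R c \<and> length c = length [parent x, x, y] + 2 * k + 1"
      using p xy k n_def hx by (intro close_path[of "parent x" n y]) (auto simp: layer_def)
    then obtain c where "closed_path R c" "length c = 2 * k + 4" by auto
    thus False using assms(1)[of c] k(1) hx * by simp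
  next
    assume *: "height y = height x \<and> height x < m"
    define n where "n = height x"
    obtain k where k: "k < n" "(parent ^^ k) x \<noteq> (parent ^^ k) y"
        "(parent ^^ Suc k) x = (parent ^^ Suc k) y"
      using ancestors_meet2[of x n y] * xy n_def unfolding layer_def by auto
    have "path R [x, y]" using xy assms(2) by (auto simp: path_def)
    hence "\<exists>c. closed_path R c \<and> length c = length [x, y] + 2 * k + 1"
      using xy k n_def * by (intro close_path[of x n y]) (auto simp: layer_def)
    then obtain c where "closed_path R c" "length c = 2 * k + 3" by auto
    thus False using assms(1)[of c] k(1) * n_def by simp
  qed
qed

text \<open>Below height \<open>m\<close> a vertex has at most its parent outside the next layer,
  hence at least \<open>q\<close> neighbours in that layer. These sets are disjoint for different
  vertices, so each layer is at least \<open>q\<close> times as large as the one before.\<close>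

lemma moore_bound:
  assumes "\<And>c. closed_path R c \<Longrightarrow> 2 * m < length c"
    and "\<And>v. v \<in> S \<Longrightarrow> q < card (R `` {v})"
  shows "q ^ m \<le> card S"
proof -
  have fin: "finite (layer i)" for i using finite_vertices unfolding layer_def by auto
  have lower: "y = parent x"
    if "(x, y) \<in> R" "height y < height x \<and> height x \<le> m \<or> height y = height x \<and> height x < m" for x y
    by (rule lower_neighbour_is_parent[of m]) (use assms(1) that in auto)
  have "q ^ i \<le> card (layer i)" if "i \<le> m" for i
    using that
  proof (induction i)
    case 0
    have "r \<in> layer 0" using root height_root by (auto simp: layer_def)
    thus ?case using fin[of 0] by (simp add: Suc_le_eq card_gt_0_iff) blast
  next
    case (Suc i)
    define C where "C x = {y \<in> layer (Suc i). (x, y) \<in> R}" for x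
    have finC: "finite (C x)" for x using fin unfolding C_def by auto
    have card_C: "q \<le> card (C x)" if x: "x \<in> layer i" for x
    proof -
      have "R `` {x} \<subseteq> insert (parent x) (C x)"
      proof
        fix y assume "y \<in> R `` {x}"
        hence xy: "(x, y) \<in> R" by auto
        show "y \<in> insert (parent x) (C x)"
        proof (cases "height y \<le> height x")
          case True
          hence "height y < height x \<and> height x \<le> m \<or> height y = height x \<and> height x < m"
            using x Suc.prems by (auto simp: layer_def)
          hence "y = parent x" by (rule lower[OF xy])
          thus ?thesis by simp
        next
          case False
          thus ?thesis using height_edge[OF xy] x edge_verts[OF xy] xy by (auto simp: C_def layer_def)
        qed
      qed
      hence "card (R `` {x}) \<le> card (insert (parent x) (C x))" using finC by (intro card_mono) auto
      also have "\<dots> \<le> Suc (card (C x))" by (rule card_insert_le_m1) (auto)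
      finally show ?thesis using assms(2)[of x] x by (auto simp: layer_def)
    qed
    \<comment> \<open>A common neighbour in the next layer has only one lower neighbour, its
      parent.\<close>
    have disj: "x = x'" if "x \<in> layer i" "x' \<in> layer i" "y \<in> C x" "y \<in> C x'" for x x' y
    proof -
      have "z = parent y" if "z \<in> layer i" "y \<in> C z" for z
        using lower[OF edge_sym, of z y] that Suc.prems
        by (auto simp: C_def layer_def)
      thus ?thesis using that by metis
    qed
    have "q ^ Suc i \<le> q * card (layer i)" using Suc by simp
    also have "\<dots> = (\<Sum>x\<in>layer i. q)" by simp
    also have "\<dots> \<le> (\<Sum>x\<in>layer i. card (C x))" by (intro sum_mono card_C)
    also have "\<dots> = card (\<Union>x\<in>layer i. C x)"
      using fin finC disj by (intro card_UN_disjoint[symmetric]) auto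
    also have "\<dots> \<le> card (layer (Suc i))"
      using fin by (intro card_mono) (auto simp: C_def)
    finally show ?case .
  qed
  hence "q ^ m \<le> card (layer m)" by simp
  also have "\<dots> \<le> card S" using finite_vertices by (intro card_mono) (auto simp: layer_def)
  finally show ?thesis .
qed

section \<open>Dense bands, and cycle lengths from a path in a band\<close>

text \<open>The bands cover all edges, while each vertex is counted in at most two of the sets
  \<open>layer i \<union> layer (Suc i)\<close>. Averaging over \<open>i\<close> thus costs a factor
  2.\<close>

lemma dense_band:
  assumes "2 * c * card S \<le> card R" "c > 0"
  shows "\<exists>i. layer i \<noteq> {} \<and> c * card (layer i \<union> layer (Suc i)) \<le> card (band i)"
proof (rule ccontr)
  assume neg: "\<not> ?thesis"
  have fin: "finite (layer i)" for i using finite_vertices unfolding layer_def by auto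
  have disj: "layer i \<inter> layer j = {}" if "i \<noteq> j" for i j using that by (auto simp: layer_def)
  have lt: "card (band i) < c * (card (layer i) + card (layer (Suc i)))" if "layer i \<noteq> {}" for i
  proof -
    have "card (layer i \<union> layer (Suc i)) = card (layer i) + card (layer (Suc i))"
      by (intro card_Un_disjoint fin disj) auto
    thus ?thesis using neg that by (metis linorder_not_le)
  qed
  have le: "card (band i) \<le> c * (card (layer i) + card (layer (Suc i)))" for i
  proof (cases "layer i = {}")
    case True
    hence "band i = {}" unfolding band_def by auto
    thus ?thesis by simp
  qed (use lt[of i] in simp)
  define n where "n = Suc (Max (height ` S))"
  have hn: "height v < n" if "v \<in> S" for v
    using that finite_vertices unfolding n_def by (auto simp: less_Suc_eq_le)
  have finb: "finite (band i)" for i using fin unfolding band_def by auto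
  have part: "(\<Sum>i<n. card (layer (f i))) \<le> card S" if "inj f" for f
  proof -
    have "(\<Sum>i<n. card (layer (f i))) = card (\<Union>i<n. layer (f i))"
      using fin that by (intro card_UN_disjoint[symmetric]) (auto simp: layer_def dest: injD)
    also have "\<dots> \<le> card S" using finite_vertices by (intro card_mono) (auto simp: layer_def)
    finally show ?thesis .
  qed
  have "R \<subseteq> (\<Union>i<n. band i)"
  proof (rule subrelI)
    fix u v assume uv: "(u, v) \<in> R"
    hence "(u, v) \<in> band (min (height u) (height v))"
      using height_edge[OF uv] height_edge[OF edge_sym[OF uv]] edge_verts[OF uv]
      by (auto simp: band_def layer_def min_def)
    moreover have "min (height u) (height v) < n"
      using hn[of u] edge_verts[OF uv] by (simp add: min_less_iff_disj)
    ultimately show "(u, v) \<in> (\<Union>i<n. band i)" by blast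
  qed
  hence "card R \<le> card (\<Union>i<n. band i)" using finb by (intro card_mono) auto
  also have "\<dots> \<le> (\<Sum>i<n. card (band i))" by (rule card_UN_le) simp
  also have "\<dots> < (\<Sum>i<n. c * (card (layer i) + card (layer (Suc i))))"
  proof (rule sum_strict_mono_ex1)
    \<comment> \<open>Strictness comes from \<open>i = 0\<close>, the layer of the root being
      nonempty.\<close>
    have "r \<in> layer 0" using root height_root by (simp add: layer_def)
    thus "\<exists>i\<in>{..<n}. card (band i) < c * (card (layer i) + card (layer (Suc i)))"
      by (intro bexI[of _ 0] lt) (auto simp: n_def)
  qed (use le in auto)
  also have "\<dots> = c * ((\<Sum>i<n. card (layer i)) + (\<Sum>i<n. card (layer (Suc i))))"
    by (simp add: sum_distrib_left sum.distrib distrib_left)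
  also have "\<dots> \<le> c * (card S + card S)"
    using part[of "\<lambda>i. i"] part[of Suc] by (intro mult_left_mono add_mono) auto
  finally show False using assms(1) by (simp add: algebra_simps)
qed

text \<open>Vertices of \<open>P\<close> in layer \<open>n\<close> are coloured by their
  \<open>k\<close>-th ancestors with \<open>k\<close> from \<open>ancestors_meet\<close>. The same
  \<open>k\<close> then serves every differently coloured pair, so distances along \<open>P\<close>
  become cycle lengths by one fixed shift.\<close>

lemma card_closed_path_lengths:
  assumes "path (band n) P" "set P \<subseteq> layer n \<union> layer (Suc n)" "4 \<le> length P"
    and "finite {length c |c. closed_path R c}"
  shows "length P div 2 \<le> 4 * card {length c |c. closed_path R c}"
proof -
  define I where "I = {t. t < length P \<and> P ! t \<in> layer n}"
  have finI: "finite I" unfolding I_def by auto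
  have distP: "distinct P" using assms(1) by (simp add: path_def)
  have half: "2 * t \<in> I \<or> Suc (2 * t) \<in> I" if "t < length P div 2" for t
  proof -
    have l: "Suc (2 * t) < length P" using that by linarith
    hence "(P ! (2 * t), P ! Suc (2 * t)) \<in> band n"
      using assms(1) unfolding path_def by (auto simp: successively_conv_nth)
    moreover have "P ! (2 * t) \<in> layer n \<union> layer (Suc n)" "P ! Suc (2 * t) \<in> layer n \<union> layer (Suc n)"
      using assms(2) l nth_mem by (meson Suc_lessD subsetD)+
    ultimately show ?thesis using l unfolding I_def band_def by auto
  qed
  \<comment> \<open>\<open>f\<close> picks from each pair of positions \<open>2 * t\<close>,
    \<open>Suc (2 * t)\<close> one in layer \<open>n\<close>; halving recovers
    \<open>t\<close>.\<close>
  define f where "f t = (if 2 * t \<in> I then 2 * t else Suc (2 * t))" for t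
  have f2: "f t div 2 = t" for t by (simp add: f_def)
  have inj: "inj_on f {..<length P div 2}" by (rule inj_on_inverseI[of _ "\<lambda>x. x div 2"]) (simp add: f2)
  have fI: "f ` {..<length P div 2} \<subseteq> I" using half by (auto simp: f_def)
  have cardI: "length P div 2 \<le> card I"
    using card_inj_on_le[OF inj fI finI] by simp
  \<comment> \<open>Four vertices of \<open>P\<close> give two such pairs, hence two vertices in
    layer \<open>n\<close>, as \<open>ancestors_meet\<close> requires.\<close>
  have 01: "f 0 \<in> I" "f 1 \<in> I" "f 0 \<noteq> f 1"
    using fI assms(3) f2[of 0] f2[of 1] by auto
  have "P ! f 0 \<noteq> P ! f 1" using 01 distP unfolding I_def by (simp add: nth_eq_iff_index_eq)
  hence ex: "\<exists>a\<in>(\<lambda>t. P ! t) ` I. \<exists>b\<in>(\<lambda>t. P ! t) ` I. a \<noteq> b" using 01 by blast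
  have sub: "(\<lambda>t. P ! t) ` I \<subseteq> layer n" unfolding I_def by auto
  obtain k where k: "k < n"
    "\<exists>a\<in>(\<lambda>t. P ! t) ` I. \<exists>b\<in>(\<lambda>t. P ! t) ` I. (parent ^^ k) a \<noteq> (parent ^^ k) b"
    "\<And>a b. a \<in> (\<lambda>t. P ! t) ` I \<Longrightarrow> b \<in> (\<lambda>t. P ! t) ` I \<Longrightarrow>
      (parent ^^ Suc k) a = (parent ^^ Suc k) b"
    by (rule ancestors_meet[OF sub ex]) blast
  define c where "c t = (parent ^^ k) (P ! t)" for t
  let ?D = "{t - s |s t. s \<in> I \<and> t \<in> I \<and> s < t \<and> c s \<noteq> c t}"
  let ?C = "{length c |c. closed_path R c}"
  have "\<exists>s\<in>I. \<exists>t\<in>I. c s \<noteq> c t" using k(2) unfolding c_def by blast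
  hence "card I \<le> 4 * card ?D" by (rule colour_distances[OF finI])
  moreover have "card ?D \<le> card ?C"
  proof (rule card_inj_on_le[OF _ _ assms(4)])
    \<comment> \<open>The segment from \<open>s\<close> to \<open>t\<close> has
      \<open>t - s + 1\<close> vertices, and \<open>close_path\<close> adds \<open>2 * k + 1\<close>
      more.\<close>
    show "inj_on (\<lambda>x. x + 2 * k + 2) ?D" by (auto simp: inj_on_def)
    show "(\<lambda>x. x + 2 * k + 2) ` ?D \<subseteq> ?C"
    proof
      fix x assume "x \<in> (\<lambda>x. x + 2 * k + 2) ` ?D"
      then obtain s t where st: "x = t - s + 2 * k + 2" "s \<in> I" "t \<in> I" "s < t" "c s \<noteq> c t"
        by blast
      define Q where "Q = take (Suc t - s) (drop s P)"
      have t: "t < length P" "s < length P" using st unfolding I_def by auto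
      have lenQ: "length Q = Suc (t - s)" using t st unfolding Q_def by auto
      have PQ: "P = take s P @ Q @ drop (Suc t - s) (drop s P)"
        unfolding Q_def by (metis append_take_drop_id)
      have "path (band n) Q" using path_sublist assms(1) PQ by metis
      hence "path R Q" by (rule path_mono) (auto simp: band_def)
      moreover have "Q \<noteq> []" using lenQ by auto
      moreover have "hd Q = P ! s" using lenQ t by (simp add: Q_def hd_conv_nth)
      moreover have "last Q = P ! t"
        using lenQ t st by (simp add: Q_def last_conv_nth)
      moreover have "n \<le> height v" if "v \<in> set Q" for v
      proof -
        have "v \<in> set P" using that unfolding Q_def by (meson in_set_dropD in_set_takeD)
        thus ?thesis using assms(2) by (auto simp: layer_def)
      qed
      moreover have "P ! s \<in> layer n" "P ! t \<in> layer n" using st unfolding I_def by auto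
      ultimately have "\<exists>c. closed_path R c \<and> length c = length Q + 2 * k + 1"
        using k(1,3) st by (intro close_path[of "P ! s" n "P ! t"]) (auto simp: c_def)
      thus "x \<in> ?C" using lenQ st by force
    qed
  qed
  ultimately show ?thesis using cardI by linarith
qed

end

section \<open>Long paths in graphs without short cycles\<close>

text \<open>A core of average degree \<open>2 * q\<close> is connected with all degrees above
  \<open>q\<close>, so the Moore bound applies to it.\<close>

lemma dense_card_ge:
  assumes "finite Y" "Y \<noteq> {}" "sym R" "irrefl R" "q > 0" "2 * q * card Y \<le> card (Restr R Y)"
    and "\<And>c. closed_path R c \<Longrightarrow> 2 * m < length c"
  shows "q ^ m \<le> card Y"
proof -
  obtain Z where Z: "Z \<subseteq> Y" "Z \<noteq> {}" "2 * q * card Z \<le> card (Restr R Z)"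
    "\<And>v. v \<in> Z \<Longrightarrow> 2 * q < 2 * card (Restr R Z `` {v})"
    "\<And>u v. u \<in> Z \<Longrightarrow> v \<in> Z \<Longrightarrow> (u, v) \<in> (Restr R Z)\<^sup>*"
    by (rule dense_core[OF assms(1-4) _ assms(6)]) (use assms(5) in simp, rule that)
  obtain r where r: "r \<in> Z" using Z by auto
  interpret connected_graph Z "Restr R Z" r
    using Z r assms(3,4) finite_subset[OF Z(1) assms(1)] by unfold_locales (auto simp: sym_def irrefl_def)
  have "q ^ m \<le> card Z"
    using Z(4) assms(7) closed_path_mono[of "Restr R Z" _ R] by (intro moore_bound) auto
  also have "\<dots> \<le> card Y" using Z(1) assms(1) by (rule card_mono[rotated])
  finally show ?thesis .
qed

lemma card_edges_ge_degree_sum: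
  assumes "finite Y" "X \<subseteq> Y" "\<And>v. v \<in> X \<Longrightarrow> D \<le> card (R `` {v})" "R `` X \<subseteq> Y"
  shows "D * card X \<le> card (Restr R Y)"
proof -
  have finX: "finite X" using finite_subset[OF assms(2,1)] .
  have fin: "finite (R `` {v})" if "v \<in> X" for v
    using that assms(1,4) by (meson Image_mono empty_subsetI finite_subset insert_subset order_refl)
  have "D * card X = (\<Sum>v\<in>X. D)" by simp
  also have "\<dots> \<le> (\<Sum>v\<in>X. card (R `` {v}))" by (intro sum_mono assms)
  also have "\<dots> = card (SIGMA v:X. R `` {v})" using finX fin by (simp add: card_SigmaI)
  also have "\<dots> \<le> card (Restr R Y)" using assms by (intro card_mono) auto
  finally show ?thesis .
qed

text \<open>Depth-first search is stopped when \<open>q ^ m div 3\<close> vertices are finished. If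
  the stack had fewer than twice as many, finished vertices and stack together would number less
  than \<open>q ^ m\<close>, yet contain all edges at the finished third, which makes them dense
  enough to contradict \<open>dense_card_ge\<close>.\<close>

lemma long_path:
  assumes "finite S" "S \<noteq> {}" "R \<subseteq> S \<times> S" "sym R" "irrefl R" "q > 0"
    and deg: "\<And>v. v \<in> S \<Longrightarrow> 6 * q \<le> card (R `` {v})"
    and short: "\<And>c. closed_path R c \<Longrightarrow> 2 * m < length c"
  shows "\<exists>P. set P \<subseteq> S \<and> path R P \<and> 2 * (q ^ m div 3) \<le> length P"
proof -
  let ?k = "q ^ m div 3"
  \<comment> \<open>The whole graph has at least \<open>q ^ m\<close> vertices, so the search can
    finish that many.\<close>
  have "6 * q * card S \<le> card (Restr R S)"
    using assms by (intro card_edges_ge_degree_sum) auto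
  hence "q ^ m \<le> card S"
    using assms by (intro dense_card_ge[of S R]) auto
  hence "?k \<le> card S" by linarith
  then obtain X P where XP: "X \<subseteq> S" "card X = ?k" "set P \<subseteq> S" "path R P" "X \<inter> set P = {}"
      "R `` X \<subseteq> X \<union> set P"
    using depth_first_search[OF assms(1,3,4)] by metis
  have "2 * ?k \<le> length P"
  proof (rule ccontr)
    assume "\<not> ?thesis"
    hence P: "length P < 2 * ?k" by simp
    define Y where "Y = X \<union> set P"
    have finX: "finite X" using finite_subset[OF XP(1) assms(1)] .
    have finY: "finite Y" using finX unfolding Y_def by auto
    have "card (set P) \<le> length P" by (rule card_length)
    hence cY: "card Y < 3 * ?k"
      using P XP(2) card_Un_le[of X "set P"] unfolding Y_def by linarith
    have "2 * q * card Y \<le> 2 * q * (3 * ?k)" using cY by (intro mult_left_mono) auto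
    also have "\<dots> = 6 * q * card X" using XP(2) by simp
    also have "\<dots> \<le> card (Restr R Y)"
      using XP(1,6) finY deg by (intro card_edges_ge_degree_sum) (auto simp: Y_def)
    finally have "2 * q * card Y \<le> card (Restr R Y)" .
    moreover have "X \<noteq> {}" using P XP(2) by auto
    ultimately have "q ^ m \<le> card Y"
      using finY assms by (intro dense_card_ge[of Y R]) (auto simp: Y_def)
    thus False using cY by linarith
  qed
  thus ?thesis using XP by blast
qed

section \<open>Combining the estimates\<close>

text \<open>The constant 24 is spent as follows: passing to a band leaves average degree
  \<open>12 * q\<close>, passing to a core of the band leaves minimum degree above
  \<open>6 * q\<close>, which is what \<open>long_path\<close> needs.\<close>

lemma card_closed_path_lengths_ge:
  assumes "finite V" "V \<noteq> {}" "R \<subseteq> V \<times> V" "sym R" "irrefl R" "q > 0"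
    and dense: "24 * q * card V \<le> card R"
    and short: "\<And>c. closed_path R c \<Longrightarrow> 2 * m < length c"
    and "6 \<le> q ^ m" and fin: "finite {length c |c. closed_path R c}"
  shows "q ^ m div 3 \<le> 4 * card {length c |c. closed_path R c}"
proof -
  have RV: "Restr R V = R" using assms(3) by auto
  obtain S where S: "S \<subseteq> V" "S \<noteq> {}" "24 * q * card S \<le> card (Restr R S)"
    "\<And>v. v \<in> S \<Longrightarrow> 24 * q < 2 * card (Restr R S `` {v})"
    "\<And>u v. u \<in> S \<Longrightarrow> v \<in> S \<Longrightarrow> (u, v) \<in> (Restr R S)\<^sup>*"
    by (rule dense_core[OF assms(1,2,4,5), of "24 * q"])
      (use assms(6) in simp, use dense RV in simp, rule that)
  obtain r where r: "r \<in> S" using S by auto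
  interpret connected_graph S "Restr R S" r
    using S r assms(4,5) finite_subset[OF S(1) assms(1)] by unfold_locales (auto simp: sym_def irrefl_def)
  obtain i where i: "layer i \<noteq> {}" "12 * q * card (layer i \<union> layer (Suc i)) \<le> card (band i)"
    using dense_band[of "12 * q"] S(3) assms(6) by auto
  let ?W = "layer i \<union> layer (Suc i)"
  have finW: "finite ?W" using finite_vertices by (auto simp: layer_def)
  have band: "sym (band i)" "irrefl (band i)" "Restr (band i) ?W = band i"
    using assms(4,5) unfolding band_def sym_def irrefl_def by auto
  have neW: "?W \<noteq> {}" using i(1) by auto
  obtain T where T: "T \<subseteq> ?W" "T \<noteq> {}" "12 * q * card T \<le> card (Restr (band i) T)"
    "\<And>v. v \<in> T \<Longrightarrow> 12 * q < 2 * card (Restr (band i) T `` {v})"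
    "\<And>u v. u \<in> T \<Longrightarrow> v \<in> T \<Longrightarrow> (u, v) \<in> (Restr (band i) T)\<^sup>*"
    by (rule dense_core[OF finW neW band(1,2), of "12 * q"])
      (use assms(6) in simp, use i(2) band(3) in simp, rule that)
  have sub: "Restr (band i) T \<subseteq> R" "band i \<subseteq> R" by (auto simp: band_def)
  have "\<exists>P. set P \<subseteq> T \<and> path (Restr (band i) T) P \<and> 2 * (q ^ m div 3) \<le> length P"
  proof (rule long_path)
    show "finite T" using finite_subset[OF T(1) finW] .
    show "6 * q \<le> card (Restr (band i) T `` {v})" if "v \<in> T" for v using T(4)[OF that] by simp
    show "2 * m < length c" if "closed_path (Restr (band i) T) c" for c
      using closed_path_mono[OF that sub(1)] by (rule short)
  qed (use T(1,2) band assms(6) in \<open>auto simp: sym_def irrefl_def\<close>)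
  then obtain P where P: "set P \<subseteq> T" "path (Restr (band i) T) P" "2 * (q ^ m div 3) \<le> length P"
    by auto
  \<comment> \<open>This is where \<open>6 \<le> q ^ m\<close> enters: the path must have four
    vertices.\<close>
  have "2 \<le> q ^ m div 3" using assms(9) by linarith
  hence P4: "4 \<le> length P" using P(3) by linarith
  have C: "{length c |c. closed_path (Restr R S) c} \<subseteq> {length c |c. closed_path R c}"
    using closed_path_mono[of "Restr R S" _ R] by blast
  have "path (band i) P" using P(2) by (rule path_mono) auto
  hence "length P div 2 \<le> 4 * card {length c |c. closed_path (Restr R S) c}"
    using P(1) T(1) P4 finite_subset[OF C fin] by (intro card_closed_path_lengths) auto
  also have "\<dots> \<le> 4 * card {length c |c. closed_path R c}" using card_mono[OF fin C] by simp
  finally show ?thesis using P(3) by linarith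
qed

section \<open>Transfer to cycles, girth and average degree\<close>

lemma closed_path_is_cycle:
  assumes "finite_simple_graph V E" "closed_path {(u, v). {u, v} \<in> E} c"
  shows "is_cycle V E c"
proof -
  have c: "3 \<le> length c" "distinct c" "(last c, hd c) \<in> {(u, v). {u, v} \<in> E}"
    "\<And>i. Suc i < length c \<Longrightarrow> {c ! i, c ! Suc i} \<in> E"
    using assms(2) unfolding closed_path_def path_def by (auto simp: successively_conv_nth)
  have E: "{c ! i, c ! (Suc i mod length c)} \<in> E" if "i < length c" for i
  proof (cases "Suc i = length c")
    case True
    hence "c \<noteq> []" "i = length c - 1" by auto
    thus ?thesis using c(3) True by (simp add: last_conv_nth hd_conv_nth)
  next
    case False
    thus ?thesis using c(4)[of i] that by simp
  qed
  have "set c \<subseteq> V"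
  proof
    fix v assume "v \<in> set c"
    then obtain i where "i < length c" "v = c ! i" by (auto simp: in_set_conv_nth)
    thus "v \<in> V" using E[of i] assms(1) unfolding finite_simple_graph_def by fastforce
  qed
  thus ?thesis using c E unfolding is_cycle_def by auto
qed

lemma card_oriented_edges:
  assumes "finite_simple_graph V E"
  shows "card {(u, v). {u, v} \<in> E} = 2 * card E"
proof -
  have "finite (Pow V)" "E \<subseteq> Pow V" using assms unfolding finite_simple_graph_def by auto
  hence finE: "finite E" by (rule finite_subset[rotated])
  have two: "card e = 2" if "e \<in> E" for e using that assms unfolding finite_simple_graph_def by auto
  have "{(u, v). {u, v} \<in> E} = (\<Union>e\<in>E. {(u, v). {u, v} = e})" by auto
  also have "card \<dots> = (\<Sum>e\<in>E. card {(u, v). {u, v} = e})"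
  proof (rule card_UN_disjoint[OF finE])
    show "\<forall>e\<in>E. finite {(u, v). {u, v} = e}"
    proof
      fix e assume "e \<in> E"
      hence "finite e" using two card.infinite by fastforce
      thus "finite {(u, v). {u, v} = e}" by - (rule finite_subset[of _ "e \<times> e"], auto)
    qed
    show "\<forall>e\<in>E. \<forall>e'\<in>E. e \<noteq> e' \<longrightarrow> {(u, v). {u, v} = e} \<inter> {(u, v). {u, v} = e'} = {}"
      by fast
  qed
  also have "\<dots> = (\<Sum>e\<in>E. 2)"
  proof (rule sum.cong)
    fix e assume "e \<in> E"
    then obtain a b where ab: "e = {a, b}" "a \<noteq> b" using two by (meson card_2_iff)
    hence "{(u, v). {u, v} = e} = {(a, b), (b, a)}" by (auto simp: doubleton_eq_iff)
    thus "card {(u, v). {u, v} = e} = 2" using ab by simp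
  qed simp
  finally show ?thesis by simp
qed

theorem theorem2p2:
  fixes V :: "'a set" and E :: "'a set set" and d g :: nat
  assumes "d > 0"
    and "finite_simple_graph V E"
    and "girth V E = enat g"
    and "average_degree V E = 48 * (real d + 1)"
  shows "real (card (cycle_lengths V E)) \<ge> 1 / 8 * real d ^ ((g - 1) div 2)"
proof -
  define m where "m = (g - 1) div 2"
  define R where "R = {(u, v). {u, v} \<in> E}"
  define C where "C = {length c |c. closed_path R c}"
  have fin: "finite (cycle_lengths V E)" using finite_cycle_lengths assms(2) .
  \<comment> \<open>With no cycle the girth would be infinite, not \<open>enat g\<close>.\<close>
  have ne: "cycle_lengths V E \<noteq> {}" using assms(3) unfolding girth_def by (auto simp: top_enat_def)
  then obtain l where "l \<in> cycle_lengths V E" by blast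
  hence "Inf (enat ` cycle_lengths V E) \<in> enat ` cycle_lengths V E"
    by (intro wellorder_InfI[of "enat l"]) auto
  hence "g \<in> cycle_lengths V E" using assms(3) unfolding girth_def by auto
  hence g3: "g \<ge> 3" unfolding cycle_lengths_def is_cycle_def by auto
  have cyc: "g \<le> l" if "l \<in> cycle_lengths V E" for l
  proof -
    have "girth V E \<le> enat l" unfolding girth_def using that by (intro Inf_lower) auto
    thus ?thesis using assms(3) by simp
  qed
  have sub: "C \<subseteq> cycle_lengths V E"
    using closed_path_is_cycle[OF assms(2)] unfolding C_def R_def cycle_lengths_def by blast
  \<comment> \<open>\<open>m\<close> is the largest number with \<open>2 * m < g\<close>.\<close>
  have m1: "m \<ge> 1" "2 * m < g" using g3 unfolding m_def by linarith+
  show ?thesis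
  proof (cases "d ^ m \<le> 8")
    \<comment> \<open>The claimed bound is at most 1, and there is a cycle.\<close>
    case True
    hence "real d ^ m \<le> 8" by (metis of_nat_le_iff of_nat_numeral of_nat_power)
    moreover have "card (cycle_lengths V E) \<ge> 1" using fin ne by (simp add: Suc_le_eq card_gt_0_iff)
    ultimately show ?thesis unfolding m_def by linarith
  next
    case False
    \<comment> \<open>\<open>24 * ?q\<close> is the given average degree; the factor 2 makes up for
      the losses by rounding in \<open>div 3\<close>.\<close>
    let ?q = "2 * (d + 1)"
    \<comment> \<open>For empty \<open>V\<close> the average degree would be 0, division by zero
      giving 0.\<close>
    have V: "finite V" "V \<noteq> {}"
      using assms(2,4) unfolding finite_simple_graph_def average_degree_def by auto
    have RV: "R \<subseteq> V \<times> V" "sym R" "irrefl R"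
      using assms(2) unfolding R_def finite_simple_graph_def sym_def irrefl_def
      by (auto simp: insert_commute)
    have "2 * real (card E) = 48 * (real d + 1) * real (card V)"
      using assms(4) V unfolding average_degree_def by (simp add: divide_eq_eq)
    hence "real (2 * card E) = real (48 * (d + 1) * card V)" by simp
    hence "2 * card E = 48 * (d + 1) * card V" by (simp only: of_nat_eq_iff)
    hence dense: "24 * ?q * card V \<le> card R"
      using card_oriented_edges[OF assms(2)] unfolding R_def by simp
    have short: "2 * m < length c" if "closed_path R c" for c
      using cyc[of "length c"] sub that m1 unfolding C_def by fastforce
    have qm: "2 * d ^ m + 2 \<le> ?q ^ m"
    proof -
      obtain n where n: "m = Suc n" using m1 by (cases m) auto
      have "2 * d ^ m + 2 \<le> ?q * d ^ n" using n assms(1) by (simp add: algebra_simps)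
      also have "\<dots> \<le> ?q * ?q ^ n" by (intro mult_left_mono power_mono) auto
      finally show ?thesis using n by simp
    qed
    have "?q ^ m div 3 \<le> 4 * card C"
      unfolding C_def
    proof (rule card_closed_path_lengths_ge[OF V RV _ dense short])
      show "6 \<le> ?q ^ m" using qm False by linarith
      show "finite {length c |c. closed_path R c}" using finite_subset[OF sub fin] C_def by simp
    qed auto
    moreover have "card C \<le> card (cycle_lengths V E)" by (rule card_mono[OF fin sub])
    \<comment> \<open>From \<open>?q ^ m \<le> 12 * card C + 2\<close> and \<open>qm\<close> even
      \<open>d ^ m \<le> 6 * card C\<close> follows; the summand 2 in \<open>qm\<close> absorbs the
      remainder of the division by 3.\<close>
    ultimately have "d ^ m \<le> 8 * card (cycle_lengths V E)" using qm by linarith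
    hence "real d ^ m \<le> 8 * real (card (cycle_lengths V E))"
      using of_nat_mono[of "d ^ m" _, where 'a = real] by fastforce
    thus ?thesis unfolding m_def by linarith
  qed
qed

end
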